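(* For every integer $M\ge 1$ and every $\gamma$ with $0<\gamma<3-\frac{3}{M+1}$, there exists a sporadic task set ${\bf T}$ with implicit deadlines ($D_i=T_i$ for all $i$) such that the deadline-monotonic partitioning algorithm with $M$ unit-speed processors, using the first-fit strategy and the per-processor test $$C_k+\sum_{\tau_i\in{\bf T}_m}\Big(1+\frac{D_k}{T_i}\Big)C_i\le D_k\quad\text{and}\quad U_k+\sum_{\tau_i\in{\bf T}_m}U_i\le 1,$$ returns failure on ${\bf T}$, while $\Lambda({\bf T})\le \frac{1}{3-\frac{3}{M+1}-\gamma}$. In particular, the speedup factor of this algorithm, as measured against the lower bound $\Lambda$, is at least $3-\frac{3}{M+1}-\gamma$.
   Context: A sporadic task $\tau_i=(C_i,T_i,D_i)$ has worst-case execution time $C_i>0$, minimum inter-arrival time $T_i>0$, and relative deadline $D_i>0$; it releases jobs with consecutive releases at least $T_i$ apart, each job having to complete within $D_i$ of its release. $U_i=C_i/T_i$, $\Delta_i=\max\{U_i,C_i/D_i\}$. Demand bound function: $\mathrm{dbf}(\tau_i,t)=\max\{0,\lfloor (t-D_i)/T_i\rfloor+1\}\cdot C_i$. For a task set ${\bf T}$ and $M$ processors, $$\Lambda({\bf T})=\max\Big\{\sup_{t>0}\frac{\sum_{\tau_i\in{\bf T}}\mathrm{dbf}(\tau_i,t)}{Mt},\ \frac{\sum_{\tau_i\in{\bf T}}U_i}{M},\ \max_{\tau_i\in{\bf T}}\Delta_i\Big\};$$ no multiprocessor scheduling algorithm can schedule ${\bf T}$ on $M$ processors of speed $s<\Lambda({\bf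 T})$. Deadline-monotonic partitioning algorithm: tasks are indexed by non-decreasing relative deadline; set ${\bf T}_1=\{\tau_1\}$, ${\bf T}_m=\emptyset$ for $m\ge2$; for $k=2,\dots,N$, if some processor $m$ has ${\bf T}_m\cup\{\tau_k\}$ passing the test, choose one such $m$ by the fitting strategy and add $\tau_k$ to ${\bf T}_m$, else return failure. First-fit chooses the smallest feasible index $m$. *)

theory Defs
  imports Complex_Main "HOL-Library.Extended_Real"
begin

datatype task = Task (wcet: real) (period: real) (deadline: real)

definition sporadic :: "task \<Rightarrow> bool" where
  "sporadic \<tau> \<longleftrightarrow> wcet \<tau> > 0 \<and> period \<tau> > 0 \<and> deadline \<tau> > 0"

definition implicit_deadline :: "task \<Rightarrow> bool" where
  "implicit_deadline \<tau> \<longleftrightarrow> deadline \<tau> = period \<tau>"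

text \<open>
  A task set is a list, so that distinct tasks may have equal parameters. It is listed in the
  order in which the tasks are indexed, that is, by non-decreasing relative deadline; ties may be
  listed in either order.
\<close>

definition task_set :: "task list \<Rightarrow> bool" where
  "task_set ts \<longleftrightarrow> ts \<noteq> [] \<and> (\<forall>\<tau>\<in>set ts. sporadic \<tau>) \<and> sorted (map deadline ts)"

definition implicit_task_set :: "task list \<Rightarrow> bool" where
  "implicit_task_set ts \<longleftrightarrow> task_set ts \<and> (\<forall>\<tau>\<in>set ts. implicit_deadline \<tau>)"

definition util :: "task \<Rightarrow> real" where
  "util \<tau> = wcet \<tau> / period \<tau>"

definition max_density :: "task \<Rightarrow> real" where
  "max_density \<tau> = max (util \<tau>) (wcet \<tau> / deadline \<tau>)"

definition dbf :: "task \<Rightarrow> real \<Rightarrow> real" where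
  "dbf \<tau> t = real_of_int (max 0 (\<lfloor>(t - deadline \<tau>) / period \<tau>\<rfloor> + 1)) * wcet \<tau>"

text \<open>
  The supremum below is a real number: its index set is nonempty, and \<open>bdd_above_demand\<close>
  shows that the function is bounded above.
\<close>

definition speed_lower_bound :: "nat \<Rightarrow> task list \<Rightarrow> real" where
  "speed_lower_bound M ts =
     max (SUP t\<in>{0<..}. (\<Sum>\<tau>\<leftarrow>ts. dbf \<tau> t) / (real M * t))
         (max ((\<Sum>\<tau>\<leftarrow>ts. util \<tau>) / real M)
              (Max (max_density ` set ts)))"

lemma dbf_le:
  assumes "sporadic \<tau>" "t > 0"
  shows "dbf \<tau> t \<le> (util \<tau> + wcet \<tau> / deadline \<tau>) * t"
proof -
  have C: "wcet \<tau> > 0" and T: "period \<tau> > 0" and D: "deadline \<tau> > 0"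
    using assms(1) by (auto simp: sporadic_def)
  show ?thesis
  proof (cases "t < deadline \<tau>")
    case True
    then have "(t - deadline \<tau>) / period \<tau> < 0"
      using T by (simp add: divide_neg_pos)
    then have "\<lfloor>(t - deadline \<tau>) / period \<tau>\<rfloor> + 1 \<le> 0"
      by linarith
    then have "dbf \<tau> t = 0"
      by (simp add: dbf_def)
    then show ?thesis
      using C T D assms(2) by (simp add: util_def)
  next
    case False
    have "real_of_int (max 0 (\<lfloor>(t - deadline \<tau>) / period \<tau>\<rfloor> + 1))
          \<le> (t - deadline \<tau>) / period \<tau> + 1"
      using False T by (simp add: max_def)
    also have "\<dots> \<le> t / period \<tau> + t / deadline \<tau>"
      using False T D by (intro add_mono divide_right_mono) auto
    finally have "dbf \<tau> t \<le> (t / period \<tau> + t / deadline \<tau>) * wcet \<tau>"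
      unfolding dbf_def using C by (intro mult_right_mono) auto
    then show ?thesis
      by (simp add: util_def algebra_simps)
  qed
qed

lemma bdd_above_demand:
  assumes "\<forall>\<tau>\<in>set ts. sporadic \<tau>"
  shows "bdd_above ((\<lambda>t. (\<Sum>\<tau>\<leftarrow>ts. dbf \<tau> t) / (real M * t)) ` {0<..})"
proof (rule bdd_aboveI2)
  fix t :: real
  assume "t \<in> {0<..}"
  then have t: "t > 0" by simp
  have "(\<Sum>\<tau>\<leftarrow>ts. dbf \<tau> t) \<le> (\<Sum>\<tau>\<leftarrow>ts. (util \<tau> + wcet \<tau> / deadline \<tau>) * t)"
    using assms t by (intro sum_list_mono dbf_le) auto
  also have "\<dots> = (\<Sum>\<tau>\<leftarrow>ts. util \<tau> + wcet \<tau> / deadline \<tau>) * t"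
    by (rule sum_list_mult_const)
  finally have "(\<Sum>\<tau>\<leftarrow>ts. dbf \<tau> t) / (real M * t)
      \<le> (\<Sum>\<tau>\<leftarrow>ts. util \<tau> + wcet \<tau> / deadline \<tau>) * t / (real M * t)"
    using t by (intro divide_right_mono) auto
  also have "\<dots> = (\<Sum>\<tau>\<leftarrow>ts. util \<tau> + wcet \<tau> / deadline \<tau>) / real M"
    using t by simp
  finally show "(\<Sum>\<tau>\<leftarrow>ts. dbf \<tau> t) / (real M * t)
      \<le> (\<Sum>\<tau>\<leftarrow>ts. util \<tau> + wcet \<tau> / deadline \<tau>) / real M" .
qed

text \<open>
  \<open>P m\<close> lists the tasks assigned so far to processor \<open>m \<in> {1..M}\<close>, \<open>test \<tau> (P m)\<close> is the
  schedulability test for adding \<open>\<tau>\<close> to them, and \<open>fit\<close> chooses from the nonempty set of feasible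
  processors. \<open>None\<close> is failure. The first task goes to processor 1 without being tested.
\<close>

primrec dm_assign :: "(nat set \<Rightarrow> nat) \<Rightarrow> (task \<Rightarrow> task list \<Rightarrow> bool) \<Rightarrow> nat
    \<Rightarrow> task list \<Rightarrow> (nat \<Rightarrow> task list) \<Rightarrow> (nat \<Rightarrow> task list) option" where
  "dm_assign fit test M [] P = Some P"
| "dm_assign fit test M (\<tau> # ts) P =
     (let F = {m \<in> {1..M}. test \<tau> (P m)}
      in if F = {} then None
         else dm_assign fit test M ts (P(fit F := \<tau> # P (fit F))))"

primrec dm_partition :: "(nat set \<Rightarrow> nat) \<Rightarrow> (task \<Rightarrow> task list \<Rightarrow> bool) \<Rightarrow> nat
    \<Rightarrow> task list \<Rightarrow> (nat \<Rightarrow> task list) option" where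
  "dm_partition fit test M [] = Some (\<lambda>_. [])"
| "dm_partition fit test M (\<tau> # ts) = dm_assign fit test M ts ((\<lambda>_. [])(1 := [\<tau>]))"

definition first_fit :: "nat set \<Rightarrow> nat" where
  "first_fit F = Min F"

definition dm_test :: "task \<Rightarrow> task list \<Rightarrow> bool" where
  "dm_test \<tau> ts \<longleftrightarrow>
     wcet \<tau> + (\<Sum>\<tau>'\<leftarrow>ts. (1 + deadline \<tau> / period \<tau>') * wcet \<tau>') \<le> deadline \<tau> \<and>
     util \<tau> + (\<Sum>\<tau>'\<leftarrow>ts. util \<tau>') \<le> 1"

text \<open>
  The speedup factor on \<open>M\<close> unit-speed processors over a class of task sets, measured against
  \<open>speed_lower_bound\<close>: the infimum of all \<open>\<rho> > 0\<close> such that failure on a task set certifies that the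
  lower bound exceeds \<open>1 / \<rho>\<close>, so that the task set cannot be scheduled at speed \<open>1 / \<rho>\<close>.
  It is \<open>\<infinity>\<close> if no such \<open>\<rho>\<close> exists.
\<close>

definition speedup_factor ::
    "(task list \<Rightarrow> bool) \<Rightarrow> (nat \<Rightarrow> task list \<Rightarrow> 'a option) \<Rightarrow> nat \<Rightarrow> ereal" where
  "speedup_factor cls alg M =
     (INF \<rho>\<in>{\<rho> :: real. \<rho> > 0 \<and>
        (\<forall>ts. cls ts \<longrightarrow> alg M ts = None \<longrightarrow> speed_lower_bound M ts > 1 / \<rho>)}. ereal \<rho>)"

end

theory Submission
  imports Defs
begin

text \<open>
  Take \<open>M + 1\<close> copies of a task with utilization \<open>u\<close> slightly above \<open>1 / 3\<close>. Since all periods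
  agree, adding a copy to a processor that already holds one would need \<open>u + 2 u \<le> 1\<close>. Each
  processor thus accepts at most one copy, and one copy remains. For implicit deadlines the demand
  never exceeds the utilization, so the lower bound is the average utilization
  \<open>(M + 1) u / M\<close>, which is as close to \<open>(M + 1) / (3 M) = 1 / (3 - 3 / (M + 1))\<close> as desired.
\<close>

text \<open>With deadline equal to period, the \<open>+ 1\<close> cancels the shift by the deadline:
  the job count is the floor of \<open>t / period \<tau>\<close>, which is at most that positive
  quotient.\<close>

lemma dbf_implicit_le:
  assumes "sporadic \<tau>" "implicit_deadline \<tau>" "t > 0"
  shows "dbf \<tau> t \<le> util \<tau> * t"
proof -
  have C: "wcet \<tau> > 0" and T: "period \<tau> > 0" and D: "deadline \<tau> = period \<tau>"
    using assms by (auto simp: sporadic_def implicit_deadline_def)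
  have "(t - deadline \<tau>) / period \<tau> = t / period \<tau> - 1"
    using T D by (simp add: diff_divide_distrib)
  moreover have "t / period \<tau> > 0"
    using T assms(3) by simp
  ultimately have "real_of_int (max 0 (\<lfloor>(t - deadline \<tau>) / period \<tau>\<rfloor> + 1)) \<le> t / period \<tau>"
    by (simp add: max_def)
  then have "dbf \<tau> t \<le> t / period \<tau> * wcet \<tau>"
    unfolding dbf_def using C by (intro mult_right_mono) auto
  then show ?thesis
    by (simp add: util_def mult.commute)
qed

text \<open>All three terms of the maximum reduce to utilizations: the demand ratio is at most the
  average utilization at every \<open>t\<close>, and each maximal density is a plain
  utilization.\<close>

lemma speed_lower_bound_implicit_le:
  assumes ts: "implicit_task_set ts" and M: "M \<ge> 1"
    and total: "(\<Sum>\<tau>\<leftarrow>ts. util \<tau>) / real M \<le> s"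
    and each: "\<And>\<tau>. \<tau> \<in> set ts \<Longrightarrow> util \<tau> \<le> s"
  shows "speed_lower_bound M ts \<le> s"
proof -
  have demand: "(\<Sum>\<tau>\<leftarrow>ts. dbf \<tau> t) / (real M * t) \<le> s" if "t > 0" for t
  proof -
    have "(\<Sum>\<tau>\<leftarrow>ts. dbf \<tau> t) \<le> (\<Sum>\<tau>\<leftarrow>ts. util \<tau> * t)"
      using ts that
      by (intro sum_list_mono dbf_implicit_le) (auto simp: implicit_task_set_def task_set_def)
    also have "\<dots> = (\<Sum>\<tau>\<leftarrow>ts. util \<tau>) * t"
      by (rule sum_list_mult_const)
    finally have "(\<Sum>\<tau>\<leftarrow>ts. dbf \<tau> t) / (real M * t) \<le> (\<Sum>\<tau>\<leftarrow>ts. util \<tau>) * t / (real M * t)"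
      using that by (intro divide_right_mono) auto
    also have "\<dots> = (\<Sum>\<tau>\<leftarrow>ts. util \<tau>) / real M"
      using that by simp
    finally show ?thesis
      using total by linarith
  qed
  have "max_density \<tau> \<le> s" if "\<tau> \<in> set ts" for \<tau>
    using each[OF that] ts that
    by (auto simp: max_density_def util_def implicit_task_set_def implicit_deadline_def)
  then have "Max (max_density ` set ts) \<le> s"
    using ts by (subst Max_le_iff) (auto simp: implicit_task_set_def task_set_def)
  moreover have "(SUP t\<in>{0<..}. (\<Sum>\<tau>\<leftarrow>ts. dbf \<tau> t) / (real M * t)) \<le> s"
    by (rule cSUP_least) (auto intro: demand)
  ultimately show ?thesis
    using total by (simp add: speed_lower_bound_def)
qed

text \<open>Every accepted task uses up an empty processor, so the pending tasks keep outnumbering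
  the empty processors until one task fits nowhere. The fixed set \<open>A\<close> covers both
  pending and placed tasks, which keeps the invariant stable while the list shrinks.\<close>

lemma dm_assign_pigeonhole:
  assumes fit: "\<And>F. F \<noteq> {} \<Longrightarrow> F \<subseteq> {1..M} \<Longrightarrow> fit F \<in> F"
    and reject: "\<And>\<tau> \<sigma>s. \<tau> \<in> A \<Longrightarrow> set \<sigma>s \<subseteq> A \<Longrightarrow> \<sigma>s \<noteq> [] \<Longrightarrow> \<not> test \<tau> \<sigma>s"
    and "set ts \<subseteq> A" and "\<And>m. set (P m) \<subseteq> A"
    and "card {m \<in> {1..M}. P m = []} < length ts"
  shows "dm_assign fit test M ts P = None"
  using assms(3-5)
proof (induction ts arbitrary: P)
  case Nil
  then show ?case by simp
next
  case (Cons \<tau> ts)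
  define F where "F = {m \<in> {1..M}. test \<tau> (P m)}"
  show ?case
  proof (cases "F = {}")
    case True
    then show ?thesis by (simp add: F_def)
  next
    case False
    define Q where "Q = P(fit F := \<tau> # P (fit F))"
    have "F \<subseteq> {1..M}"
      by (auto simp: F_def)
    then have "fit F \<in> F"
      by (rule fit[OF False])
    \<comment> \<open>By \<open>reject\<close>, a processor that passes the test cannot hold any
      task yet.\<close>
    then have m: "fit F \<in> {m \<in> {1..M}. P m = []}"
      using reject Cons.prems by (fastforce simp: F_def)
    have "{m \<in> {1..M}. Q m = []} \<subset> {m \<in> {1..M}. P m = []}"
      using m by (auto simp: Q_def)
    then have "card {m \<in> {1..M}. Q m = []} < card {m \<in> {1..M}. P m = []}"
      by (intro psubset_card_mono) auto
    then have "dm_assign fit test M ts Q = None"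
      using Cons.prems by (intro Cons.IH) (auto simp: Q_def)
    then show ?thesis
      using False by (simp add: F_def Q_def Let_def)
  qed
qed

lemma dm_partition_pigeonhole:
  assumes "\<And>F. F \<noteq> {} \<Longrightarrow> F \<subseteq> {1..M} \<Longrightarrow> fit F \<in> F"
    and "\<And>\<tau> \<sigma>s. \<tau> \<in> set ts \<Longrightarrow> set \<sigma>s \<subseteq> set ts \<Longrightarrow> \<sigma>s \<noteq> [] \<Longrightarrow> \<not> test \<tau> \<sigma>s"
    and "M \<ge> 1" and "M < length ts"
  shows "dm_partition fit test M ts = None"
proof (cases ts)
  case Nil
  then show ?thesis using assms(4) by simp
next
  case (Cons \<tau> ts')
  \<comment> \<open>The untested first task occupies processor 1, leaving \<open>M - 1\<close> empty
    processors for at least \<open>M\<close> further tasks.\<close>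
  have "{m \<in> {1..M}. ((\<lambda>_. [])(1 := [\<tau>])) m = []} = {2..M}"
    by auto
  then have "card {m \<in> {1..M}. ((\<lambda>_. [])(1 := [\<tau>])) m = []} < length ts'"
    using assms(3,4) Cons by simp
  then have "dm_assign fit test M ts' ((\<lambda>_. [])(1 := [\<tau>])) = None"
    using Cons by (intro dm_assign_pigeonhole[where A = "set ts"] assms(1,2)) auto
  then show ?thesis
    using Cons by simp
qed

lemma first_fit_in: "finite F \<Longrightarrow> F \<noteq> {} \<Longrightarrow> first_fit F \<in> F"
  by (simp add: first_fit_def)

lemma dm_test_copies_fail:
  assumes "u > 1 / 3" "set \<sigma>s \<subseteq> {Task u 1 1}" "\<sigma>s \<noteq> []"
  shows "\<not> dm_test (Task u 1 1) \<sigma>s"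
proof -
  obtain \<sigma> \<sigma>s' where \<sigma>s: "\<sigma>s = \<sigma> # \<sigma>s'"
    using assms(3) by (cases \<sigma>s) auto
  \<comment> \<open>One resident copy already breaks the first inequality of the test; the others
    can only add load.\<close>
  have "(\<Sum>\<tau>\<leftarrow>\<sigma>s'. (1 + 1 / period \<tau>) * wcet \<tau>) \<ge> 0"
    using assms(1,2) \<sigma>s by (intro sum_list_nonneg) auto
  then show ?thesis
    using assms(1,2) \<sigma>s by (simp add: dm_test_def)
qed

text \<open>One failing task set suffices: any admissible \<open>\<rho>'\<close> must satisfy
  \<open>1 / \<rho>' < 1 / \<rho>\<close>, so \<open>\<rho>\<close> lies below the whole index set
  of the infimum.\<close>

lemma speedup_factor_ge:
  assumes "cls ts" "alg M ts = None" "speed_lower_bound M ts \<le> 1 / \<rho>" "\<rho> > 0"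
  shows "ereal \<rho> \<le> speedup_factor cls alg M"
  unfolding speedup_factor_def
proof (rule INF_greatest, clarsimp)
  fix \<rho>' :: real
  assume "\<rho>' > 0"
    and "\<forall>ts. cls ts \<longrightarrow> alg M ts = None \<longrightarrow> 1 / \<rho>' < speed_lower_bound M ts"
  then have "1 / \<rho>' < 1 / \<rho>"
    using assms(1-3) by fastforce
  then show "\<rho> \<le> \<rho>'"
    using \<open>\<rho>' > 0\<close> assms(4) by (simp add: field_simps)
qed

theorem theorem3:
  fixes M :: nat and \<gamma> :: real
  assumes "M \<ge> 1" and "0 < \<gamma>" and "\<gamma> < 3 - 3 / (real M + 1)"
  shows "(\<exists>ts. implicit_task_set ts \<and>
            dm_partition first_fit dm_test M ts = None \<and>
            speed_lower_bound M ts \<le> 1 / (3 - 3 / (real M + 1) - \<gamma>))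
       \<and> ereal (3 - 3 / (real M + 1) - \<gamma>)
            \<le> speedup_factor implicit_task_set (dm_partition first_fit dm_test) M
       \<and> ereal (3 - 3 / (real M + 1) - \<gamma>)
            \<le> speedup_factor task_set (dm_partition first_fit dm_test) M"
proof -
  define \<rho> where "\<rho> = 3 - 3 / (real M + 1) - \<gamma>"
  \<comment> \<open>This solves \<open>(M + 1) * u / M = 1 / \<rho>\<close>, so the average
    utilization meets the target exactly; the slack \<open>\<gamma>\<close> then makes
    \<open>u > 1 / 3\<close> strict.\<close>
  define u where "u = real M / ((real M + 1) * \<rho>)"
  define ts where "ts = replicate (M + 1) (Task u 1 1)"
  have \<rho>: "\<rho> > 0"
    using assms(3) by (simp add: \<rho>_def)
  have "(real M + 1) * \<rho> = 3 * real M - \<gamma> * (real M + 1)"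
    by (simp add: \<rho>_def field_simps)
  moreover have "\<gamma> * (real M + 1) > 0"
    using assms(2) by simp
  ultimately have "(real M + 1) * \<rho> < 3 * real M"
    by linarith
  then have u: "u > 1 / 3"
    using \<rho> by (simp add: u_def less_divide_eq)
  have average: "(real M + 1) * u / real M = 1 / \<rho>"
    using assms(1) \<rho> by (simp add: u_def)
  have "real M / (real M + 1) * (1 / \<rho>) \<le> 1 * (1 / \<rho>)"
    using \<rho> by (intro mult_right_mono) auto
  then have u_le: "u \<le> 1 / \<rho>"
    by (simp add: u_def)
  have implicit: "implicit_task_set ts"
    using u
    by (auto simp: ts_def implicit_task_set_def task_set_def sporadic_def implicit_deadline_def
        sorted_replicate simp del: replicate_Suc)
  have failure: "dm_partition first_fit dm_test M ts = None"
  proof (rule dm_partition_pigeonhole)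
    show "first_fit F \<in> F" if "F \<noteq> {}" "F \<subseteq> {1..M}" for F
      using that by (intro first_fit_in) (auto intro: finite_subset)
    show "\<not> dm_test \<tau> \<sigma>s" if "\<tau> \<in> set ts" "set \<sigma>s \<subseteq> set ts" "\<sigma>s \<noteq> []" for \<tau> \<sigma>s
      using that dm_test_copies_fail[OF u, of \<sigma>s] by (simp add: ts_def del: replicate_Suc)
  qed (use assms(1) in \<open>auto simp: ts_def\<close>)
  have "(\<Sum>\<tau>\<leftarrow>ts. util \<tau>) = (real M + 1) * u"
    by (simp add: ts_def util_def sum_list_replicate algebra_simps)
  then have bound: "speed_lower_bound M ts \<le> 1 / \<rho>"
    using average u_le
    by (intro speed_lower_bound_implicit_le implicit assms(1)) (auto simp: ts_def util_def)
  \<comment> \<open>The class stays arbitrary because the same witness serves both implicit-deadline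
    and general task sets.\<close>
  have "ereal \<rho> \<le> speedup_factor cls (dm_partition first_fit dm_test) M" if "cls ts" for cls
    using that failure bound \<rho> by (rule speedup_factor_ge)
  then show ?thesis
    using implicit failure bound unfolding \<rho>_def[symmetric]
    by (auto simp: implicit_task_set_def)
qed

end
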